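(* Let $p,q$ be complex deformation parameters and let $D\geq 1$ be an integer. For a representation of the two-parametric quantum group $U_{p,q}[sl(2)]$ (from the family of highest weight representations described in the context) of given finite dimension $D$, the highest weight $j$ is given by $$2j=\log_{pq}\left(\frac{[D]_p}{[D]_q}\right)+D-1\qquad\text{or}\qquad 2j=\frac{\ln\left(\frac{[D]_p}{[D]_q}\right)}{\ln(pq)}+D-1,$$ if the logarithms here are well-defined.
   Context: Here $p,q$ are nonzero complex numbers with $p^2\neq q^2$, such that the denominators below do not vanish ($pq\neq1$, $p^2\neq1$, $q^2\neq1$). Put $$[x]_{p,q}=\frac{q^x-p^{-x}}{q-p^{-1}},\qquad [x]_q=\frac{q^x-q^{-x}}{q-q^{-1}},\qquad [x]_p=\frac{p^x-p^{-x}}{p-p^{-1}}.$$ The quantum group $U_{p,q}[sl(2)]$ is generated by $E_+,E_-,H$ with relations $$[H,E_\pm]=\pm E_\pm,\qquad [E_+,E_-]=[2H]_{p,q}.$$ Its representation with highest weight ("spin") $j$, where $j$ is a complex number, not necessarily integral or half-integral, is induced from a vector $|j,j\rangle$ with $H|j,j\rangle=j|j,j\rangle$ and $E_+|j,j\rangle=0$. It has basis $|j,m\rangle$, $m=j-n$, $n=0,1,2,\dots$, and action $$H|j,m\rangle=m|j,m\rangle,$$ $$E_+|j,m\rangle=\left(\frac{q^{j+m+1}[j-m]_q-p^{-j-m-1}[j-m]_p}{q-p^{-1}}\right)^{1/2}|j,m+1\rangle,$$ $$E_-|j,m\rangle=\left(\frac{q^{j+m}[j-m+1]_q-p^{-j-m}[j-m+1]_p}{q-p^{-1}}\right)^{1/2}|j,m-1\rangle.$$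 In general this representation is infinite-dimensional. A finite-dimensional representation is extracted from it when the matrix element of $E_-$ vanishes for some non-negative integer value $x$ of $j-m$, i.e. when $$q^{2j-x}[x+1]_q-p^{-2j+x}[x+1]_p=0.$$ If $x=N$ is the smallest non-negative integer solving this equation, the dimension of the corresponding finite-dimensional representation is $D=N+1$, which may differ from $2j+1$. Conversely, one can choose $j$ so as to get a representation of a given finite dimension $D$, by solving the equation for $j$ with $x=D-1$; the claim gives the resulting $j$. *)

theory Defs
  imports "HOL-Analysis.Analysis" "HOL-Library.Function_Algebras"
begin

text \<open>
  Complex powers of a deformation parameter depend on a choice of its logarithm. The parameters
  are therefore represented by logarithms \<open>lp\<close>, \<open>lq\<close> with \<open>p = exp lp\<close>, \<open>q = exp lq\<close> (for instance,
  but not necessarily, the principal ones), and \<open>p\<^sup>x = exp (x * lp)\<close>. The logarithm of \<open>pq\<close>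
  compatible with \<open>(pq)\<^sup>x = p\<^sup>x q\<^sup>x\<close> is \<open>lp + lq\<close>.
\<close>

definition cpow :: "complex \<Rightarrow> complex \<Rightarrow> complex" where
  "cpow l x = exp (x * l)"

definition qnum2 :: "complex \<Rightarrow> complex \<Rightarrow> complex \<Rightarrow> complex" where
  "qnum2 lp lq x = (cpow lq x - cpow lp (- x)) / (exp lq - inverse (exp lp))"

definition qnum :: "complex \<Rightarrow> complex \<Rightarrow> complex" where
  "qnum l x = (cpow l x - cpow l (- x)) / (exp l - inverse (exp l))"

text \<open>The values of the multivalued natural logarithm, and those of the logarithm to a base whose
  own logarithm is \<open>l\<close>.\<close>

definition ln_values :: "complex \<Rightarrow> complex set" where
  "ln_values z = {w. exp w = z}"

definition log_values :: "complex \<Rightarrow> complex \<Rightarrow> complex set" where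
  "log_values l z = {w. cpow l w = z}"

text \<open>
  Vectors are coefficient functions: \<open>f\<close> stands for the sum of \<open>f n |j, j - n\<rangle>\<close> over \<open>n\<close>.
  The representation space is \<open>spin_space\<close>, the span of the basis vectors, that is,
  the functions of finite support.
\<close>

definition cscale :: "complex \<Rightarrow> (nat \<Rightarrow> complex) \<Rightarrow> (nat \<Rightarrow> complex)" where
  "cscale c f = (\<lambda>n. c * f n)"

interpretation cfun: vector_space cscale
  by unfold_locales (auto simp: cscale_def fun_eq_iff algebra_simps)

definition ket :: "nat \<Rightarrow> (nat \<Rightarrow> complex)" where
  "ket n = (\<lambda>k. if k = n then 1 else 0)"

definition spin_space :: "(nat \<Rightarrow> complex) set" where
  "spin_space = cfun.span (range ket)"

definition Eplus_coeff :: "complex \<Rightarrow> complex \<Rightarrow> complex \<Rightarrow> complex \<Rightarrow> complex" where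
  "Eplus_coeff lp lq j m =
     csqrt ((cpow lq (j + m + 1) * qnum lq (j - m) - cpow lp (- j - m - 1) * qnum lp (j - m))
            / (exp lq - inverse (exp lp)))"

definition Eminus_coeff :: "complex \<Rightarrow> complex \<Rightarrow> complex \<Rightarrow> complex \<Rightarrow> complex" where
  "Eminus_coeff lp lq j m =
     csqrt ((cpow lq (j + m) * qnum lq (j - m + 1) - cpow lp (- j - m) * qnum lp (j - m + 1))
            / (exp lq - inverse (exp lp)))"

definition Hop :: "complex \<Rightarrow> (nat \<Rightarrow> complex) \<Rightarrow> (nat \<Rightarrow> complex)" where
  "Hop j f = (\<lambda>n. (j - of_nat n) * f n)"

definition Eplus :: "complex \<Rightarrow> complex \<Rightarrow> complex \<Rightarrow> (nat \<Rightarrow> complex) \<Rightarrow> (nat \<Rightarrow> complex)" where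
  "Eplus lp lq j f = (\<lambda>n. Eplus_coeff lp lq j (j - of_nat (Suc n)) * f (Suc n))"

definition Eminus :: "complex \<Rightarrow> complex \<Rightarrow> complex \<Rightarrow> (nat \<Rightarrow> complex) \<Rightarrow> (nat \<Rightarrow> complex)" where
  "Eminus lp lq j f =
     (\<lambda>n. case n of 0 \<Rightarrow> 0 | Suc k \<Rightarrow> Eminus_coeff lp lq j (j - of_nat k) * f k)"

text \<open>The operators have the intended action on the basis and satisfy the defining relations.\<close>

lemma Hop_ket: "Hop j (ket n) = cscale (j - of_nat n) (ket n)"
  by (auto simp: Hop_def ket_def cscale_def fun_eq_iff)

lemma Eplus_ket_0: "Eplus lp lq j (ket 0) = 0"
  by (auto simp: Eplus_def ket_def fun_eq_iff)

lemma Eplus_ket_Suc: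
  "Eplus lp lq j (ket (Suc n)) = cscale (Eplus_coeff lp lq j (j - of_nat (Suc n))) (ket n)"
  by (auto simp: Eplus_def ket_def cscale_def fun_eq_iff)

lemma Eminus_ket:
  "Eminus lp lq j (ket n) = cscale (Eminus_coeff lp lq j (j - of_nat n)) (ket (Suc n))"
  by (auto simp: Eminus_def ket_def cscale_def fun_eq_iff split: nat.splits)

lemma comm_H_Eplus: "Hop j (Eplus lp lq j f) - Eplus lp lq j (Hop j f) = Eplus lp lq j f"
  by (auto simp: Hop_def Eplus_def fun_eq_iff algebra_simps)

lemma comm_H_Eminus: "Hop j (Eminus lp lq j f) - Eminus lp lq j (Hop j f) = - Eminus lp lq j f"
  by (auto simp: Hop_def Eminus_def fun_eq_iff algebra_simps split: nat.splits)

lemma qnum_Suc: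
  assumes "exp l ^ 2 \<noteq> 1"
  shows "qnum l (x + 1) - exp l * qnum l x = cpow l (- x)"
    and "qnum l (x + 1) - inverse (exp l) * qnum l x = cpow l x"
proof -
  have nz: "exp l - inverse (exp l) \<noteq> 0"
    using assms by (auto simp: field_simps power2_eq_square)
  have s: "cpow l (x + 1) = exp l * cpow l x" "cpow l (- (x + 1)) = inverse (exp l) * cpow l (- x)"
    by (simp_all add: cpow_def ring_distribs exp_add exp_diff exp_minus field_simps)
  show "qnum l (x + 1) - exp l * qnum l x = cpow l (- x)"
    and "qnum l (x + 1) - inverse (exp l) * qnum l x = cpow l x"
    unfolding qnum_def s using nz by (simp_all add: divide_simps) (simp_all add: algebra_simps)
qed

lemma comm_Eplus_Eminus:
  assumes "exp lp ^ 2 \<noteq> 1" "exp lq ^ 2 \<noteq> 1"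
  shows "Eplus lp lq j (Eminus lp lq j f) - Eminus lp lq j (Eplus lp lq j f)
       = (\<lambda>n. qnum2 lp lq (2 * (j - of_nat n)) * f n)"
proof
  fix n
  define g where "g n = (cpow lq (2 * j - of_nat n + 1) * qnum lq (of_nat n)
      - cpow lp (- 2 * j + of_nat n - 1) * qnum lp (of_nat n)) / (exp lq - inverse (exp lp))" for n
  have P: "Eplus_coeff lp lq j (j - of_nat n) = csqrt (g n)" for n
    by (simp add: Eplus_coeff_def g_def algebra_simps)
  have M: "Eminus_coeff lp lq j (j - of_nat n) = csqrt (g (Suc n))" for n
    by (simp add: Eminus_coeff_def g_def algebra_simps)
  have g0: "g 0 = 0" by (simp add: g_def qnum_def)
  have q: "cpow lq (2 * j - of_nat (Suc n) + 1) * qnum lq (of_nat (Suc n))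
      - cpow lq (2 * j - of_nat n + 1) * qnum lq (of_nat n) = cpow lq (2 * (j - of_nat n))"
  proof -
    have "cpow lq (2 * j - of_nat (Suc n) + 1) * qnum lq (of_nat (Suc n))
      - cpow lq (2 * j - of_nat n + 1) * qnum lq (of_nat n) = cpow lq (2 * j - of_nat n) *
        (qnum lq (of_nat n + 1) - exp lq * qnum lq (of_nat n))"
      by (simp add: cpow_def ring_distribs exp_add exp_diff exp_minus field_simps)
    also have "\<dots> = cpow lq (2 * j - of_nat n) * cpow lq (- of_nat n)"
      using qnum_Suc(1)[OF assms(2)] by simp
    also have "\<dots> = cpow lq (2 * (j - of_nat n))"
      by (simp add: cpow_def exp_add[symmetric] algebra_simps)
    finally show ?thesis .
  qed
  have p: "cpow lp (- 2 * j + of_nat (Suc n) - 1) * qnum lp (of_nat (Suc n))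
      - cpow lp (- 2 * j + of_nat n - 1) * qnum lp (of_nat n) = cpow lp (- (2 * (j - of_nat n)))"
  proof -
    have "cpow lp (- 2 * j + of_nat (Suc n) - 1) * qnum lp (of_nat (Suc n))
      - cpow lp (- 2 * j + of_nat n - 1) * qnum lp (of_nat n) = cpow lp (- 2 * j + of_nat n) *
        (qnum lp (of_nat n + 1) - inverse (exp lp) * qnum lp (of_nat n))"
      by (simp add: cpow_def ring_distribs exp_add exp_diff exp_minus field_simps)
    also have "\<dots> = cpow lp (- 2 * j + of_nat n) * cpow lp (of_nat n)"
      using qnum_Suc(2)[OF assms(1)] by simp
    also have "\<dots> = cpow lp (- (2 * (j - of_nat n)))"
      by (simp add: cpow_def exp_add[symmetric] algebra_simps)
    finally show ?thesis .
  qed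
  have step: "g (Suc n) - g n = qnum2 lp lq (2 * (j - of_nat n))"
    unfolding g_def qnum2_def q[symmetric] p[symmetric] diff_divide_distrib[symmetric] by simp
  have sq: "csqrt z * csqrt z = z" for z
    using power2_csqrt[of z] by (simp add: power2_eq_square)
  have "(Eplus lp lq j (Eminus lp lq j f) - Eminus lp lq j (Eplus lp lq j f)) n
      = (g (Suc n) - g n) * f n"
  proof (cases n)
    case 0
    then show ?thesis
      using M[of 0] P[of "Suc 0"] g0 sq[of "g (Suc 0)"]
      by (simp add: Eplus_def Eminus_def)
  next
    case (Suc k)
    then show ?thesis
      using M[of n] M[of k] P[of n] P[of "Suc n"] sq[of "g (Suc n)"] sq[of "g n"]
      by (simp add: Eplus_def Eminus_def ring_distribs flip: mult.assoc)
  qed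
  then show "(Eplus lp lq j (Eminus lp lq j f) - Eminus lp lq j (Eplus lp lq j f)) n
      = qnum2 lp lq (2 * (j - of_nat n)) * f n"
    unfolding step .
qed

definition subrep :: "complex \<Rightarrow> complex \<Rightarrow> complex \<Rightarrow> (nat \<Rightarrow> complex) set \<Rightarrow> bool" where
  "subrep lp lq j W \<longleftrightarrow> cfun.subspace W \<and> W \<subseteq> spin_space \<and>
     (\<forall>f\<in>W. Hop j f \<in> W \<and> Eplus lp lq j f \<in> W \<and> Eminus lp lq j f \<in> W)"

text \<open>The library's \<open>dim\<close> is \<open>0\<close> on infinite-dimensional spaces, hence the first conjunct.\<close>

definition has_finite_dim :: "(nat \<Rightarrow> complex) set \<Rightarrow> nat \<Rightarrow> bool" where
  "has_finite_dim W D \<longleftrightarrow> (\<exists>B. finite B \<and> cfun.span B = W) \<and> cfun.dim W = D"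

text \<open>
  The representation extracted from the spin \<open>j\<close> space is the one generated by the highest weight
  vector: it is spanned by \<open>|j, j - n\<rangle>\<close> for \<open>n = 0, \<dots>, N\<close> if \<open>N\<close> is the
  least \<open>x\<close> for which the matrix element of \<open>Eminus\<close> at \<open>m = j - x\<close> vanishes.
\<close>

definition hw_rep :: "complex \<Rightarrow> complex \<Rightarrow> complex \<Rightarrow> (nat \<Rightarrow> complex) set" where
  "hw_rep lp lq j = (subrep lp lq j) hull {ket 0}"

end

theory Submission
  imports Defs
begin

text \<open>
  The matrix element of \<open>Eminus\<close> from level \<open>D - 1\<close> to level \<open>D\<close> vanishes iff
  \<open>(pq)\<^bsup>2j - D + 1\<^esup>\<close> equals \<open>[D]\<^sub>p / [D]\<^sub>q\<close>, which is the formula for \<open>j\<close>. If it vanishes,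
  the first \<open>D\<close> kets span a subrepresentation. Conversely, the highest weight vector generates
  kets until the first vanishing matrix element, at level \<open>N\<close> say, so the representation that it
  generates has dimension \<open>N + 1\<close>.
\<close>

lemma inj_ket: "inj ket"
  by (auto simp: inj_def ket_def fun_eq_iff split: if_splits)

lemma card_ket_image: "card (ket ` A) = card A"
  by (rule card_image) (rule inj_on_subset[OF inj_ket subset_UNIV])

lemma sum_cscale_ket:
  assumes "finite A"
  shows "(\<Sum>n\<in>A. cscale (c n) (ket n)) = (\<lambda>k. if k \<in> A then c k else 0)"
  using assms by (induction A) (auto simp: fun_eq_iff cscale_def ket_def)

text \<open>Turns membership in a span into a support condition, which can be checked coordinatewise
  for the operators.\<close>

lemma span_ket_image:
  assumes "finite A"
  shows "cfun.span (ket ` A) = {f. \<forall>n. n \<notin> A \<longrightarrow> f n = 0}"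
proof
  show "cfun.span (ket ` A) \<subseteq> {f. \<forall>n. n \<notin> A \<longrightarrow> f n = 0}"
    by (rule cfun.span_minimal) (auto simp: ket_def cfun.subspace_def cscale_def)
next
  show "{f. \<forall>n. n \<notin> A \<longrightarrow> f n = 0} \<subseteq> cfun.span (ket ` A)"
  proof
    fix f :: "nat \<Rightarrow> complex" assume "f \<in> {f. \<forall>n. n \<notin> A \<longrightarrow> f n = 0}"
    then have f: "f = (\<Sum>n\<in>A. cscale (f n) (ket n))"
      by (auto simp: sum_cscale_ket[OF assms] fun_eq_iff)
    have "(\<Sum>n\<in>A. cscale (f n) (ket n)) \<in> cfun.span (ket ` A)"
      by (intro cfun.span_sum cfun.span_scale cfun.span_base imageI)
    with f show "f \<in> cfun.span (ket ` A)" by simp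
  qed
qed

lemma independent_ket_image:
  assumes "finite A"
  shows "cfun.independent (ket ` A)"
  unfolding cfun.dependent_def
proof safe
  fix n assume "n \<in> A" "ket n \<in> cfun.span (ket ` A - {ket n})"
  moreover have "ket ` A - {ket n} = ket ` (A - {n})"
    using inj_ket by (auto simp: inj_def)
  ultimately have "ket n n = 0"
    using span_ket_image[of "A - {n}"] assms by auto
  then show False by (simp add: ket_def)
qed

lemma has_finite_dim_span_ket: "has_finite_dim (cfun.span (ket ` {..<D})) D"
proof -
  have "cfun.dim (ket ` {..<D}) = card (ket ` {..<D})"
    by (intro cfun.dim_eq_card_independent independent_ket_image) simp
  then show ?thesis
    by (auto simp: has_finite_dim_def card_ket_image intro!: exI[of _ "ket ` {..<D}"])
qed

text \<open>A basis extracted from the finite spanning set has \<open>cfun.dim W\<close> elements,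
  and the exchange lemma bounds independent sets by it.\<close>

lemma has_finite_dim_card_le:
  assumes "has_finite_dim W D" "cfun.independent S" "S \<subseteq> W"
  shows "card S \<le> D"
proof -
  obtain B where B: "finite B" "cfun.span B = W"
    using assms(1) by (auto simp: has_finite_dim_def)
  obtain B' where B': "B' \<subseteq> B" "cfun.independent B'" "cfun.span B' = cfun.span B"
    by (metis cfun.maximal_independent_subset cfun.span_eq cfun.span_superset subset_trans)
  have fin: "finite B'" using B B' finite_subset by blast
  have "cfun.dim W = card B'"
    using cfun.dim_eq_card_independent[OF B'(2)] B(2) B'(3) cfun.dim_span by metis
  then show ?thesis
    using cfun.independent_span_bound[OF fin assms(2)] assms(1,3) B(2) B'(3)
    by (simp add: has_finite_dim_def)
qed

text \<open>\<open>Hop\<close> keeps supports and \<open>Eplus\<close> lowers indices.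
  \<open>Eminus\<close> raises them by one, so only the coordinate at \<open>D\<close> could leave
  the span, and its coefficient vanishes.\<close>

lemma subrep_span_ket:
  assumes "D \<ge> 1" "Eminus_coeff lp lq j (j - of_nat (D - 1)) = 0"
  shows "subrep lp lq j (cfun.span (ket ` {..<D}))"
proof -
  have "Eminus lp lq j f n = 0" if f: "\<forall>n\<ge>D. f n = 0" and "n \<ge> D" for f n
  proof -
    obtain k where k: "n = Suc k" using \<open>n \<ge> D\<close> assms(1) by (cases n) auto
    show ?thesis
    proof (cases "k \<ge> D")
      case False
      then have "k = D - 1" using k \<open>n \<ge> D\<close> by simp
      then show ?thesis using assms(2) k by (simp add: Eminus_def)
    qed (use f k in \<open>simp add: Eminus_def\<close>)
  qed
  then show ?thesis
    unfolding subrep_def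
    by (auto simp: spin_space_def span_ket_image Hop_def Eplus_def not_less
        cfun.subspace_def cscale_def
        intro: subsetD[OF cfun.span_mono[of "ket ` {..<D}" "range ket"]])
qed

text \<open>In every subrepresentation containing \<open>ket 0\<close>, climb with
  \<open>Eminus\<close> and divide out its nonzero coefficients.\<close>

lemma ket_mem_hw_rep:
  assumes "\<forall>k<n. Eminus_coeff lp lq j (j - of_nat k) \<noteq> 0"
  shows "ket n \<in> hw_rep lp lq j"
  unfolding hw_rep_def hull_def
proof (rule InterI)
  fix W assume "W \<in> {W. subrep lp lq j W \<and> {ket 0} \<subseteq> W}"
  then have W: "{ket 0} \<subseteq> W" "subrep lp lq j W" by auto
  show "ket n \<in> W"
    using assms
  proof (induction n)
    case 0
    then show ?case using W by simp
  next
    case (Suc n)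
    let ?c = "Eminus_coeff lp lq j (j - of_nat n)"
    have "cscale ?c (ket (Suc n)) \<in> W"
      using Suc W unfolding Eminus_ket[symmetric] subrep_def by auto
    then have "cscale (inverse ?c) (cscale ?c (ket (Suc n))) \<in> W"
      using W by (meson cfun.subspace_scale subrep_def)
    then show ?case using Suc.prems by (simp add: cfun.scale_scale)
  qed
qed

lemma Eminus_coeff_eq_0_of_hw_rep_dim:
  assumes "D \<ge> 1" "has_finite_dim (hw_rep lp lq j) D"
  shows "Eminus_coeff lp lq j (j - of_nat (D - 1)) = 0"
proof -
  let ?z = "\<lambda>n. Eminus_coeff lp lq j (j - of_nat n) = 0"
  have "\<exists>n<D. ?z n"
  proof (rule ccontr)
    assume "\<not> (\<exists>n<D. ?z n)"
    \<comment> \<open>Reaching \<open>ket D\<close> uses only the coefficients at levels below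
      \<open>D\<close>, so this gives \<open>D + 1\<close> independent vectors.\<close>
    then have "ket ` {..<Suc D} \<subseteq> hw_rep lp lq j"
      by (auto intro!: ket_mem_hw_rep)
    then have "card (ket ` {..<Suc D}) \<le> D"
      using has_finite_dim_card_le[OF assms(2)] independent_ket_image by blast
    then show False by (simp add: card_ket_image del: image_Suc_lessThan)
  qed
  then obtain n where n: "n < D" "?z n" by blast
  have "hw_rep lp lq j \<subseteq> cfun.span (ket ` {..<Suc n})"
    unfolding hw_rep_def
    by (rule hull_minimal) (use n subrep_span_ket[of "Suc n"] in \<open>auto intro: cfun.span_base\<close>)
  then have "cfun.dim (hw_rep lp lq j) \<le> card (ket ` {..<Suc n})"
    by (rule cfun.dim_le_card) simp
  then have "D \<le> Suc n"
    using assms(2) by (simp only: has_finite_dim_def card_ket_image card_lessThan)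
  with n have "n = D - 1" by simp
  with n show ?thesis by simp
qed

text \<open>The square root vanishes iff its radicand does; multiplying the numerator by a power of
  \<open>p\<close> then merges the powers of \<open>p\<close> and \<open>q\<close> into one power of
  \<open>pq\<close>.\<close>

lemma Eminus_coeff_eq_0_iff:
  assumes "D \<ge> 1" "exp lp * exp lq \<noteq> 1" "qnum lq (of_nat D) \<noteq> 0"
  shows "Eminus_coeff lp lq j (j - of_nat (D - 1)) = 0 \<longleftrightarrow>
    exp ((2 * j - of_nat D + 1) * (lp + lq)) = qnum lp (of_nat D) / qnum lq (of_nat D)"
proof -
  define t where "t = 2 * j - of_nat D + 1"
  have den: "exp lq - inverse (exp lp) \<noteq> 0"
    using assms(2) by (auto simp: field_simps)
  \<comment> \<open>\<open>D \<ge> 1\<close> makes the natural number \<open>D - 1\<close> a true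
    difference.\<close>
  have args: "j + (j - of_nat (D - 1)) = t" "j - (j - of_nat (D - 1)) + 1 = of_nat D"
    "- j - (j - of_nat (D - 1)) = - t"
    using assms(1) by (simp_all add: t_def of_nat_diff)
  have "Eminus_coeff lp lq j (j - of_nat (D - 1)) = 0 \<longleftrightarrow>
      exp (t * lq) * qnum lq (of_nat D) = exp (- (t * lp)) * qnum lp (of_nat D)"
    unfolding Eminus_coeff_def args using den by (simp add: cpow_def)
  also have "\<dots> \<longleftrightarrow> exp (t * (lp + lq)) = qnum lp (of_nat D) / qnum lq (of_nat D)"
    using assms(3) by (simp add: exp_minus exp_add ring_distribs field_simps)
  finally show ?thesis unfolding t_def .
qed

text \<open>The converse is about the span of the first \<open>D\<close> kets: a zero at level
  \<open>D - 1\<close> does not exclude an earlier one, which would make \<open>hw_rep\<close>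
  smaller.\<close>

theorem proposition3:
  fixes p q lp lq j :: complex and D :: nat
  assumes "p \<noteq> 0" and "q \<noteq> 0"
    and "exp lp = p" and "exp lq = q"
    and "p\<^sup>2 \<noteq> q\<^sup>2" and "p * q \<noteq> 1" and "p\<^sup>2 \<noteq> 1" and "q\<^sup>2 \<noteq> 1"
    and "D \<ge> 1"
    and "qnum lp (of_nat D) \<noteq> 0" and "qnum lq (of_nat D) \<noteq> 0"
  shows
    "(has_finite_dim (hw_rep lp lq j) D \<longrightarrow>
        (\<exists>w \<in> log_values (lp + lq) (qnum lp (of_nat D) / qnum lq (of_nat D)).
           2 * j = w + of_nat D - 1) \<and>
        (\<exists>w \<in> ln_values (qnum lp (of_nat D) / qnum lq (of_nat D)).
           2 * j = w / (lp + lq) + of_nat D - 1)) \<and>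
     ((\<exists>w \<in> log_values (lp + lq) (qnum lp (of_nat D) / qnum lq (of_nat D)).
           2 * j = w + of_nat D - 1) \<or>
      (\<exists>w \<in> ln_values (qnum lp (of_nat D) / qnum lq (of_nat D)).
           2 * j = w / (lp + lq) + of_nat D - 1) \<longrightarrow>
        subrep lp lq j (cfun.span (ket ` {..<D})) \<and>
        has_finite_dim (cfun.span (ket ` {..<D})) D)"
proof -
  let ?r = "qnum lp (of_nat D) / qnum lq (of_nat D)"
  let ?z = "Eminus_coeff lp lq j (j - of_nat (D - 1)) = 0"
  have pq: "exp lp * exp lq \<noteq> 1" using assms by simp
  have l: "lp + lq \<noteq> 0" using pq by (auto simp flip: exp_add)
  note z = Eminus_coeff_eq_0_iff[OF \<open>D \<ge> 1\<close> pq \<open>qnum lq (of_nat D) \<noteq> 0\<close>]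
  \<comment> \<open>Here and in \<open>ln\<close>, the formula for \<open>j\<close> determines
    \<open>w\<close>, so the existential over logarithm values collapses to one exponential
    equation, with no choice of branch.\<close>
  have log: "(\<exists>w \<in> log_values (lp + lq) ?r. 2 * j = w + of_nat D - 1) \<longleftrightarrow> ?z"
  proof -
    have "2 * j = w + of_nat D - 1 \<longleftrightarrow> w = 2 * j - of_nat D + 1" for w
      by (auto simp: algebra_simps)
    then show ?thesis unfolding z by (simp add: log_values_def cpow_def)
  qed
  have ln: "(\<exists>w \<in> ln_values ?r. 2 * j = w / (lp + lq) + of_nat D - 1) \<longleftrightarrow> ?z"
  proof -
    have "2 * j = w / (lp + lq) + of_nat D - 1 \<longleftrightarrow> w = (2 * j - of_nat D + 1) * (lp + lq)" for w
    proof -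
      have "2 * j = w / (lp + lq) + of_nat D - 1 \<longleftrightarrow> w / (lp + lq) = 2 * j - of_nat D + 1"
        by (auto simp: algebra_simps)
      then show ?thesis using l by (simp add: nonzero_divide_eq_eq)
    qed
    then show ?thesis unfolding z by (simp add: ln_values_def)
  qed
  show ?thesis
    unfolding log ln
    using Eminus_coeff_eq_0_of_hw_rep_dim subrep_span_ket has_finite_dim_span_ket \<open>D \<ge> 1\<close> by blast
qed

end
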